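(* Let the instantaneous signal-to-noise ratio (SNR) $\gamma$ of a multiple-input single-output link with $M$ transmit antennas using maximum ratio transmission be distributed as $\gamma\sim\mathrm{Gamma}(M,\zeta)$, and let $g(\gamma)=1+\gamma$, so that the service per time slot is $\log g(\gamma)=\log(1+\gamma)$. In the low SNR regime, the Mellin transform $\mathcal{M}_{g(\gamma)}(s)=\mathbb{E}\left[(1+\gamma)^{s-1}\right]$ of the service process is approximately given as $$\mathcal{M}^{\mathrm{L}}_{g(\gamma)}(s) = \left(1-(s-1)\zeta\right)^{-M}, \qquad s<\zeta^{-1}-1.$$
   Context: $M$ is a positive integer and $\mathrm{Gamma}(M,\zeta)$ is the gamma distribution with shape parameter $M$ and scale parameter $\zeta>0$, with density $\frac{x^{M-1}e^{-x/\zeta}}{\Gamma(M)\zeta^M}$ for $x\ge0$. The scale parameter is $\zeta=\left(\sigma_{\mathrm e}^2+\frac{1+\sigma_{\mathrm e}^2}{\mathsf{snr}}\right)^{-1}$, where $\mathsf{snr}$ is the average received SNR and $\sigma_{\mathrm e}^2\ge 0$ is the variance of the transmitter's channel estimation error ($\sigma_{\mathrm e}^2=0$, i.e. $\zeta=\mathsf{snr}$, for perfect channel knowledge). The Mellin transform of a nonnegative random variable $X$ is $\mathcal{M}_X(s)=\mathbb{E}[X^{s-1}]$, considered for real $s$ for which the expectation exists. The superscript $\mathrm{L}$ marks the low-SNR approximation of the transform; no error bound is stated, the approximation being the one that results from the first-order expansion $\log(1+\gamma)\approx\gamma$. *)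

theory Defs
  imports "HOL-Probability.Probability"
begin

definition gamma_density :: "nat \<Rightarrow> real \<Rightarrow> real \<Rightarrow> real" where
  "gamma_density M \<zeta> x =
     (if x < 0 then 0 else x ^ (M - 1) * exp (- x / \<zeta>) / (Gamma (real M) * \<zeta> ^ M))"

lemma gamma_density_eq_erlang_density:
  assumes "M > 0" "\<zeta> > 0"
  shows "gamma_density M \<zeta> = erlang_density (M - 1) (1 / \<zeta>)"
proof -
  obtain k where M: "M = Suc k"
    using assms(1) gr0_implies_Suc by blast
  show ?thesis
    using assms(2) Gamma_fact[of k, where 'a = real]
    by (auto simp: fun_eq_iff gamma_density_def erlang_density_def M field_simps power_divide)
qed

definition snr_scale :: "real \<Rightarrow> real \<Rightarrow> real" where
  "snr_scale sigma_e snr = inverse (sigma_e\<^sup>2 + (1 + sigma_e\<^sup>2) / snr)"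

(* The Bochner integral of a non-integrable function is 0, so existence of the
   expectation is a separate notion. *)
definition mellin_exists :: "'a measure \<Rightarrow> ('a \<Rightarrow> real) \<Rightarrow> real \<Rightarrow> bool" where
  "mellin_exists P X s \<longleftrightarrow> integrable P (\<lambda>\<omega>. X \<omega> powr (s - 1))"

definition mellin :: "'a measure \<Rightarrow> ('a \<Rightarrow> real) \<Rightarrow> real \<Rightarrow> real" where
  "mellin P X s = (\<integral>\<omega>. X \<omega> powr (s - 1) \<partial>P)"

definition first_order_expansion :: "(real \<Rightarrow> real) \<Rightarrow> real \<Rightarrow> real \<Rightarrow> real" where
  "first_order_expansion f a x = f a + deriv f a * (x - a)"

(* Since g = exp (ln g), the low-SNR approximation of the Mellin transform of g(\<gamma>) is
   the Mellin transform of the variable in which the service ln (g(\<gamma>)) is replaced by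
   its first-order expansion at zero SNR. *)
definition low_snr_service :: "(real \<Rightarrow> real) \<Rightarrow> real \<Rightarrow> real" where
  "low_snr_service g x = exp (first_order_expansion (\<lambda>y. ln (g y)) 0 x)"

end

(* Tilting the gamma density by exp(t x) gives a multiple of the gamma density with scale
   \<zeta> / (1 - t \<zeta>), so the transform at s is the constant of proportionality for t = s - 1. *)
theory Submission
  imports Defs
begin

text \<open>At zero SNR, ln (1 + y) has value 0 and slope 1, so the linearised service is \<gamma>
  itself and the approximating variable is exp \<gamma>. Its Mellin transform at s is the moment
  generating function of the gamma law at t = s - 1. By \<open>gamma_density_tilt\<close> the
  integrand is a constant times another gamma density, and that density has mass 1, so the constant
  is the value (\<open>gamma_density_exp_integral\<close>). The exact transform exists as well,
  since (1 + x) powr t is dominated by 1 + exp (t x) on x \<ge> 0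
  (\<open>integrable_gamma_density_powr\<close>).\<close>

lemma snr_scale_pos:
  assumes "snr > 0"
  shows "snr_scale sigma_e snr > 0"
proof -
  have "(1 + sigma_e\<^sup>2) / snr > 0"
    using assms by (simp add: add_pos_nonneg)
  then show ?thesis
    by (simp add: snr_scale_def add_nonneg_pos)
qed

text \<open>The tangent of ln (1 + y) at 0 is y.\<close>

lemma low_snr_service_add_one: "low_snr_service (\<lambda>y. 1 + y) x = exp x"
proof -
  have "((\<lambda>y. ln (1 + y)) has_real_derivative 1) (at 0)"
    by (auto intro!: derivative_eq_intros)
  then show ?thesis
    by (simp add: low_snr_service_def first_order_expansion_def DERIV_imp_deriv)
qed

lemma has_bochner_integral_gamma_density:
  assumes "M > 0" "\<zeta> > 0"
  shows "has_bochner_integral lborel (gamma_density M \<zeta>) 1"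
  \<comment> \<open>The moment of order 0 is the total mass; the Erlang density takes the rate 1 /
    \<zeta> and the shape minus one.\<close>
  using nn_integral_erlang_ith_moment[of "1 / \<zeta>" "M - 1" 0] assms
  by (intro has_bochner_integral_nn_integral) (auto simp: gamma_density_eq_erlang_density)

lemma borel_measurable_gamma_density:
  assumes "M > 0" "\<zeta> > 0"
  shows "gamma_density M \<zeta> \<in> borel_measurable lborel"
  using has_bochner_integral_gamma_density[OF assms] by (auto simp: has_bochner_integral_iff)

lemma gamma_density_nonneg: "\<zeta> > 0 \<Longrightarrow> 0 \<le> gamma_density M \<zeta> x"
  \<comment> \<open>For \<open>M = 0\<close> the density is identically 0, as \<open>Gamma 0\<close>
    and division by it both default to 0.\<close>
  by (cases "M = 0") (auto simp: gamma_density_def Gamma_real_nonneg)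

text \<open>The exponents combine to -x (1 - t \<zeta>) / \<zeta>, which is the exponent for scale
  \<zeta> / (1 - t \<zeta>); the constant is the ratio of the normalising factors, the M-th powers
  of the two scales. Positivity of 1 - t \<zeta> makes the new scale positive.\<close>

lemma gamma_density_tilt:
  assumes "\<zeta> > 0" "t * \<zeta> < 1"
  shows "gamma_density M \<zeta> x * exp (t * x) =
    (1 - t * \<zeta>) powi (- int M) * gamma_density M (\<zeta> / (1 - t * \<zeta>)) x"
proof -
  have pos: "1 - t * \<zeta> > 0"
    using assms by simp
  have "exp (- x / \<zeta>) * exp (t * x) = exp (- x / (\<zeta> / (1 - t * \<zeta>)))"
    using assms pos by (simp add: exp_add[symmetric] field_simps)
  then show ?thesis
    using assms pos
    by (simp add: gamma_density_def power_int_minus power_divide field_simps)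
qed

lemma gamma_density_exp_integral:
  assumes "M > 0" "\<zeta> > 0" "t * \<zeta> < 1"
  shows "has_bochner_integral lborel (\<lambda>x. gamma_density M \<zeta> x * exp (t * x))
    ((1 - t * \<zeta>) powi (- int M))"
proof -
  have "has_bochner_integral lborel (gamma_density M (\<zeta> / (1 - t * \<zeta>))) 1"
    using assms by (intro has_bochner_integral_gamma_density) auto
  then have "has_bochner_integral lborel
      (\<lambda>x. (1 - t * \<zeta>) powi (- int M) * gamma_density M (\<zeta> / (1 - t * \<zeta>)) x)
      ((1 - t * \<zeta>) powi (- int M) * 1)"
    by (rule has_bochner_integral_mult_right)
  then show ?thesis
    using assms by (simp only: gamma_density_tilt mult_1_right)
qed

text \<open>For t \<ge> 0 this rests on 1 + x \<le> exp x; for t < 0 the left side is at most 1. The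
  sum covers both signs with a single majorant.\<close>

lemma one_plus_powr_le:
  fixes x t :: real
  assumes "x \<ge> 0"
  shows "(1 + x) powr t \<le> 1 + exp (t * x)"
proof (cases "t \<ge> 0")
  case True
  have "(1 + x) powr t \<le> exp x powr t"
    using assms True by (intro powr_mono2) auto
  also have "\<dots> = exp (t * x)"
    by (simp add: powr_def)
  finally show ?thesis by simp
next
  case False
  have "(1 + x) powr t \<le> (1 + x) powr 0"
    using assms False by (intro powr_mono) auto
  also have "\<dots> \<le> 1"
    by simp
  finally show ?thesis
    by (smt (verit) exp_gt_zero)
qed

lemma integrable_gamma_density_powr:
  assumes "M > 0" "\<zeta> > 0" "t * \<zeta> < 1"
  shows "integrable lborel (\<lambda>x. gamma_density M \<zeta> x * (1 + x) powr t)"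
proof (rule Bochner_Integration.integrable_bound)
  show "integrable lborel (\<lambda>x. gamma_density M \<zeta> x + gamma_density M \<zeta> x * exp (t * x))"
    using has_bochner_integral_gamma_density[of M \<zeta>] gamma_density_exp_integral[of M \<zeta> t] assms
    by (auto simp: has_bochner_integral_iff)
  show "(\<lambda>x. gamma_density M \<zeta> x * (1 + x) powr t) \<in> borel_measurable lborel"
    using borel_measurable_gamma_density[of M \<zeta>] assms by measurable
  have "norm (gamma_density M \<zeta> x * (1 + x) powr t)
      \<le> norm (gamma_density M \<zeta> x + gamma_density M \<zeta> x * exp (t * x))" for x
  \<comment> \<open>The density vanishes for x < 0, so the majorant is needed only on x \<ge>
    0.\<close>
  proof (cases "x < 0")
    case True
    then show ?thesis
      by (simp add: gamma_density_def)
  next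
    case False
    have "gamma_density M \<zeta> x * (1 + x) powr t \<le> gamma_density M \<zeta> x * (1 + exp (t * x))"
      using False assms by (intro mult_left_mono one_plus_powr_le gamma_density_nonneg) auto
    then show ?thesis
      using gamma_density_nonneg[OF assms(2), of M x] by (simp add: abs_mult algebra_simps)
  qed
  then show "AE x in lborel. norm (gamma_density M \<zeta> x * (1 + x) powr t)
      \<le> norm (gamma_density M \<zeta> x + gamma_density M \<zeta> x * exp (t * x))"
    by simp
qed

theorem corollary4:
  fixes P :: "'a measure" and \<gamma> :: "'a \<Rightarrow> real" and g :: "real \<Rightarrow> real"
    and M :: nat and snr sigma_e \<zeta> s :: real
  assumes "prob_space P"
    and "M > 0"
    and "snr > 0"
    and "\<zeta> = snr_scale sigma_e snr"
    and "distributed P lborel \<gamma> (\<lambda>x. ennreal (gamma_density M \<zeta> x))"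
    and "g = (\<lambda>x. 1 + x)"
    and "s < inverse \<zeta> - 1"
  shows "mellin_exists P (\<lambda>\<omega>. g (\<gamma> \<omega>)) s
    \<and> mellin_exists P (\<lambda>\<omega>. low_snr_service g (\<gamma> \<omega>)) s
    \<and> mellin P (\<lambda>\<omega>. low_snr_service g (\<gamma> \<omega>)) s = (1 - (s - 1) * \<zeta>) powi (- int M)"
proof -
  have \<zeta>: "\<zeta> > 0"
    using assms(3,4) snr_scale_pos by simp
  \<comment> \<open>Convergence of the exponential moment: s - 1 < s + 1 < 1 / \<zeta>, multiplied
    by \<zeta> > 0.\<close>
  have t: "(s - 1) * \<zeta> < 1"
  proof -
    have "(s - 1) * \<zeta> < inverse \<zeta> * \<zeta>"
      using assms(7) \<zeta> by (intro mult_strict_right_mono) auto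
    then show ?thesis
      using \<zeta> by simp
  qed
  \<comment> \<open>Both existence and value of an expectation under \<open>P\<close> become
    statements about Lebesgue integrals against the gamma density.\<close>
  note transfer = distributed_integrable[OF assms(5) _ gamma_density_nonneg[OF \<zeta>]]
    distributed_integral[OF assms(5) _ gamma_density_nonneg[OF \<zeta>]]
  have low: "low_snr_service g (\<gamma> \<omega>) powr (s - 1) = exp ((s - 1) * \<gamma> \<omega>)" for \<omega>
    by (simp add: assms(6) low_snr_service_add_one powr_def)
  have exp_int: "has_bochner_integral lborel (\<lambda>x. gamma_density M \<zeta> x * exp ((s - 1) * x))
      ((1 - (s - 1) * \<zeta>) powi (- int M))"
    using assms(2) \<zeta> t by (rule gamma_density_exp_integral)
  have "mellin_exists P (\<lambda>\<omega>. g (\<gamma> \<omega>)) s"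
    using transfer(1)[of "\<lambda>x. (1 + x) powr (s - 1)"]
      integrable_gamma_density_powr[OF assms(2) \<zeta> t]
    by (simp add: mellin_exists_def assms(6))
  moreover have "mellin_exists P (\<lambda>\<omega>. low_snr_service g (\<gamma> \<omega>)) s"
    using transfer(1)[of "\<lambda>x. exp ((s - 1) * x)"] exp_int
    by (simp add: mellin_exists_def low has_bochner_integral_iff)
  moreover have "mellin P (\<lambda>\<omega>. low_snr_service g (\<gamma> \<omega>)) s = (1 - (s - 1) * \<zeta>) powi (- int M)"
    using transfer(2)[of "\<lambda>x. exp ((s - 1) * x)"] exp_int
    by (simp add: mellin_def low has_bochner_integral_iff)
  ultimately show ?thesis
    by blast
qed

end
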